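(* Let $\mathcal H$ be a complex Hilbert space, let $m\ge1$ be an integer, and let $T\in\mathcal B(\mathcal H)$ be an $m$-partial isometry. (a) If $m$ is even and $r(T)>1$, then $T$ has no $m'$-isometric dilation for any integer $m'\ge1$. (b) If $m=3$, then $T$ has a $3$-isometric dilation.
   Context: $\mathcal B(\mathcal H)$ denotes the bounded linear operators on $\mathcal H$. For $T\in\mathcal B(\mathcal H)$ and an integer $m\ge1$, let $\beta_m(T)=\sum_{k=0}^m(-1)^{m-k}\binom mk T^{*k}T^k$. $T$ is an $m$-isometry if $\beta_m(T)=0$, and an $m$-partial isometry if $T\beta_m(T)=0$. $r(T)$ is the spectral radius of $T$. An $m'$-isometric dilation of $T\in\mathcal B(\mathcal H)$ is an $m'$-isometry $V\in\mathcal B(\mathcal K)$ on a Hilbert space $\mathcal K$ containing $\mathcal H$ as a closed subspace such that $T^n=P_{\mathcal H}V^n|_{\mathcal H}$ for all integers $n\ge0$, where $P_{\mathcal H}$ is the orthogonal projection of $\mathcal K$ onto $\mathcal H$. *)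

theory Defs
  imports "HOL-Analysis.Analysis"
begin

section \<open>Complex Hilbert spaces\<close>

text \<open>
  A complex inner product space is presented as a complex vector space with a sesquilinear form
  (linear in the first argument) on top of the library class of real inner product spaces; the
  real inner product is the real part of the complex one.  Since \<^term>\<open>cinner x x\<close> is real by
  conjugate symmetry, positive definiteness and the formula for the norm come from the class
  \<^class>\<open>real_inner\<close>.
\<close>

class complex_inner = real_inner +
  fixes scaleC :: "complex \<Rightarrow> 'a \<Rightarrow> 'a" (infixr "*\<^sub>C" 75)
    and cinner :: "'a \<Rightarrow> 'a \<Rightarrow> complex"
  assumes scaleC_add_right: "a *\<^sub>C (x + y) = a *\<^sub>C x + a *\<^sub>C y"
    and scaleC_add_left: "(a + b) *\<^sub>C x = a *\<^sub>C x + b *\<^sub>C x"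
    and scaleC_scaleC: "a *\<^sub>C b *\<^sub>C x = (a * b) *\<^sub>C x"
    and scaleR_scaleC: "r *\<^sub>R x = complex_of_real r *\<^sub>C x"
    and cinner_commute: "cinner x y = cnj (cinner y x)"
    and cinner_add_left: "cinner (x + y) z = cinner x z + cinner y z"
    and cinner_scaleC_left: "cinner (a *\<^sub>C x) y = a * cinner x y"
    and inner_eq_Re_cinner: "inner x y = Re (cinner x y)"

class chilbert_space = complex_inner + complete_space

subclass (in chilbert_space) banach ..

instantiation complex :: chilbert_space
begin

definition scaleC_complex :: "complex \<Rightarrow> complex \<Rightarrow> complex"
  where "scaleC_complex a x = a * x"

definition cinner_complex :: "complex \<Rightarrow> complex \<Rightarrow> complex"
  where "cinner_complex x y = x * cnj y"

instance
  by standard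
    (auto simp: scaleC_complex_def cinner_complex_def algebra_simps inner_complex_def
      scaleR_conv_of_real)

end

lemma cinner_self: "cinner x x = complex_of_real ((norm x)\<^sup>2)"
proof -
  have "Im (cinner x x) = 0"
    using arg_cong[OF cinner_commute[of x x], of Im] by simp
  then show ?thesis
    by (simp add: complex_eq_iff power2_norm_eq_inner inner_eq_Re_cinner)
qed

lemma norm_scaleC: "norm (a *\<^sub>C x) = cmod a * norm (x :: 'a :: complex_inner)"
proof -
  have "cinner (a *\<^sub>C x) (a *\<^sub>C x) = a * cnj (a * cinner x x)"
    using cinner_scaleC_left cinner_commute by metis
  also have "\<dots> = complex_of_real ((cmod a * norm x)\<^sup>2)"
    by (simp add: cinner_self power_mult_distrib complex_norm_square[symmetric]
        flip: mult.assoc of_real_power)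
  finally have "(norm (a *\<^sub>C x))\<^sup>2 = (cmod a * norm x)\<^sup>2"
    by (simp only: cinner_self of_real_eq_iff)
  then show ?thesis
    by (simp add: power2_eq_iff_nonneg)
qed

lemma cmod_cinner_le: "cmod (cinner x y) \<le> norm x * norm (y :: 'a :: complex_inner)"
proof (cases "cinner x y = 0")
  case False
  define u where "u = cnj (sgn (cinner x y))"
  have u: "cmod u = 1"
    using False by (simp add: u_def norm_sgn)
  have "u * cinner x y = complex_of_real (cmod (cinner x y))"
  proof -
    have "u * cinner x y = cnj (cinner x y) * cinner x y / cmod (cinner x y)"
      by (simp add: u_def sgn_eq)
    also have "\<dots> = complex_of_real ((cmod (cinner x y))\<^sup>2 / cmod (cinner x y))"
      using complex_norm_square[of "cinner x y"] by (simp add: mult.commute)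
    finally show ?thesis
      by (simp add: power2_eq_square)
  qed
  then have "cmod (cinner x y) = Re (cinner (u *\<^sub>C x) y)"
    by (simp add: cinner_scaleC_left)
  also have "\<dots> = inner (u *\<^sub>C x) y"
    by (simp add: inner_eq_Re_cinner)
  also have "\<dots> \<le> norm (u *\<^sub>C x) * norm y"
    by (rule norm_cauchy_schwarz)
  finally show ?thesis
    by (simp add: norm_scaleC u)
qed simp


section \<open>Square-summable sequences\<close>

text \<open>
  The Hilbert space of square-summable sequences with entries in a Hilbert space.  It serves as the
  dilation space in the existence statement.
\<close>

lemma summable_norm_add_square:
  fixes f g :: "nat \<Rightarrow> 'a :: real_inner"
  assumes "summable (\<lambda>n. (norm (f n))\<^sup>2)" "summable (\<lambda>n. (norm (g n))\<^sup>2)"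
  shows "summable (\<lambda>n. (norm (f n + g n))\<^sup>2)"
proof (rule summable_comparison_test')
  show "summable (\<lambda>n. 2 * (norm (f n))\<^sup>2 + 2 * (norm (g n))\<^sup>2)"
    by (intro summable_add summable_mult assms)
  fix n
  have "(norm (f n + g n))\<^sup>2 \<le> (norm (f n) + norm (g n))\<^sup>2"
    by (intro power_mono norm_triangle_ineq) auto
  also have "\<dots> \<le> 2 * (norm (f n))\<^sup>2 + 2 * (norm (g n))\<^sup>2"
    using zero_le_power2[of "norm (f n) - norm (g n)"]
    by (simp add: power2_eq_square algebra_simps)
  finally show "norm ((norm (f n + g n))\<^sup>2) \<le> 2 * (norm (f n))\<^sup>2 + 2 * (norm (g n))\<^sup>2"
    by simp
qed

lemma summable_norm_scaleC_square:
  fixes f :: "nat \<Rightarrow> 'a :: complex_inner"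
  assumes "summable (\<lambda>n. (norm (f n))\<^sup>2)"
  shows "summable (\<lambda>n. (norm (a *\<^sub>C f n))\<^sup>2)"
  using summable_mult[OF assms, of "(cmod a)\<^sup>2"] by (simp add: norm_scaleC power_mult_distrib)

lemma summable_mult_norm:
  fixes f g :: "nat \<Rightarrow> 'a :: real_inner"
  assumes "summable (\<lambda>n. (norm (f n))\<^sup>2)" "summable (\<lambda>n. (norm (g n))\<^sup>2)"
  shows "summable (\<lambda>n. norm (f n) * norm (g n))"
proof (rule summable_comparison_test')
  show "summable (\<lambda>n. (norm (f n))\<^sup>2 + (norm (g n))\<^sup>2)"
    by (intro summable_add assms)
  fix n
  have "2 * (norm (f n) * norm (g n)) \<le> (norm (f n))\<^sup>2 + (norm (g n))\<^sup>2"
    using zero_le_power2[of "norm (f n) - norm (g n)"]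
    by (simp add: power2_eq_square algebra_simps)
  moreover have "0 \<le> norm (f n) * norm (g n)"
    by simp
  ultimately show "norm (norm (f n) * norm (g n)) \<le> (norm (f n))\<^sup>2 + (norm (g n))\<^sup>2"
    unfolding real_norm_def by linarith
qed

typedef (overloaded) 'a ell2 =
  "{f :: nat \<Rightarrow> 'a :: complex_inner. summable (\<lambda>n. (norm (f n))\<^sup>2)}"
  morphisms ell2_nth Abs_ell2
  by (rule exI[of _ "\<lambda>_. 0"]) simp

lemma summable_ell2: "summable (\<lambda>n. (norm (ell2_nth f n))\<^sup>2)"
  using ell2_nth[of f] by simp

lemma ell2_nth_Abs:
  "summable (\<lambda>n. (norm (f n))\<^sup>2) \<Longrightarrow> ell2_nth (Abs_ell2 f) = f"
  by (simp add: Abs_ell2_inverse)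

lemma ell2_eqI: "(\<And>n. ell2_nth f n = ell2_nth g n) \<Longrightarrow> f = g"
  by (metis ell2_nth_inject ext)

lemma summable_ell2_mult_norm:
  fixes f g :: "'a :: complex_inner ell2"
  shows "summable (\<lambda>n. norm (ell2_nth f n) * norm (ell2_nth g n))"
  by (rule summable_mult_norm[OF summable_ell2 summable_ell2])

lemma summable_ell2_cinner: "summable (\<lambda>n. cinner (ell2_nth f n) (ell2_nth g n))"
  by (rule summable_comparison_test'[OF summable_ell2_mult_norm[of f g]]) (rule cmod_cinner_le)

lemma summable_ell2_inner: "summable (\<lambda>n. inner (ell2_nth f n) (ell2_nth g n))"
  by (rule summable_comparison_test'[OF summable_ell2_mult_norm[of f g]])
    (simp add: Cauchy_Schwarz_ineq2)

instantiation ell2 :: (complex_inner) complex_inner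
begin

definition zero_ell2 :: "'a ell2"
  where "0 = Abs_ell2 (\<lambda>_. 0)"

definition plus_ell2 :: "'a ell2 \<Rightarrow> 'a ell2 \<Rightarrow> 'a ell2"
  where "f + g = Abs_ell2 (\<lambda>n. ell2_nth f n + ell2_nth g n)"

definition scaleC_ell2 :: "complex \<Rightarrow> 'a ell2 \<Rightarrow> 'a ell2"
  where "a *\<^sub>C f = Abs_ell2 (\<lambda>n. a *\<^sub>C ell2_nth f n)"

definition scaleR_ell2 :: "real \<Rightarrow> 'a ell2 \<Rightarrow> 'a ell2"
  where "r *\<^sub>R f = complex_of_real r *\<^sub>C (f :: 'a ell2)"

definition uminus_ell2 :: "'a ell2 \<Rightarrow> 'a ell2"
  where "- f = (- 1) *\<^sub>C (f :: 'a ell2)"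

definition minus_ell2 :: "'a ell2 \<Rightarrow> 'a ell2 \<Rightarrow> 'a ell2"
  where "f - g = f + - (g :: 'a ell2)"

definition cinner_ell2 :: "'a ell2 \<Rightarrow> 'a ell2 \<Rightarrow> complex"
  where "cinner f g = (\<Sum>n. cinner (ell2_nth f n) (ell2_nth g n))"

definition inner_ell2 :: "'a ell2 \<Rightarrow> 'a ell2 \<Rightarrow> real"
  where "inner f g = (\<Sum>n. inner (ell2_nth f n) (ell2_nth g n))"

definition norm_ell2 :: "'a ell2 \<Rightarrow> real"
  where "norm f = sqrt (inner f (f :: 'a ell2))"

definition sgn_ell2 :: "'a ell2 \<Rightarrow> 'a ell2"
  where "sgn f = inverse (norm f) *\<^sub>R (f :: 'a ell2)"

definition dist_ell2 :: "'a ell2 \<Rightarrow> 'a ell2 \<Rightarrow> real"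
  where "dist f g = norm (f - g :: 'a ell2)"

definition uniformity_ell2 :: "('a ell2 \<times> 'a ell2) filter"
  where "uniformity_ell2 = (INF e\<in>{0 <..}. principal {(x, y). dist x y < e})"

definition open_ell2 :: "'a ell2 set \<Rightarrow> bool"
  where "open_ell2 S = (\<forall>x\<in>S. \<forall>\<^sub>F (x', y) in uniformity. x' = x \<longrightarrow> y \<in> S)"

lemma ell2_nth_zero [simp]: "ell2_nth (0 :: 'a ell2) n = 0"
  by (simp add: zero_ell2_def ell2_nth_Abs)

lemma ell2_nth_add [simp]: "ell2_nth (f + g :: 'a ell2) n = ell2_nth f n + ell2_nth g n"
  by (simp add: plus_ell2_def ell2_nth_Abs summable_norm_add_square summable_ell2)

lemma ell2_nth_scaleC [simp]: "ell2_nth (a *\<^sub>C f :: 'a ell2) n = a *\<^sub>C ell2_nth f n"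
  by (simp add: scaleC_ell2_def ell2_nth_Abs summable_norm_scaleC_square summable_ell2)

lemma ell2_nth_scaleR [simp]: "ell2_nth (r *\<^sub>R f :: 'a ell2) n = r *\<^sub>R ell2_nth f n"
  by (simp add: scaleR_ell2_def scaleR_scaleC)

lemma ell2_nth_minus [simp]: "ell2_nth (- f :: 'a ell2) n = - ell2_nth f n"
  using scaleR_scaleC[of "- 1" "ell2_nth f n"] by (simp add: uminus_ell2_def)

lemma ell2_nth_diff [simp]: "ell2_nth (f - g :: 'a ell2) n = ell2_nth f n - ell2_nth g n"
  by (simp add: minus_ell2_def)

instance
proof
  fix f g h :: "'a ell2" and a b :: complex and r s :: real
  show "f + g + h = f + (g + h)" "f + g = g + f" "0 + f = f" "- f + f = 0" "f - g = f + - g"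
    by (rule ell2_eqI, simp add: algebra_simps)+
  show "r *\<^sub>R (f + g) = r *\<^sub>R f + r *\<^sub>R g" "(r + s) *\<^sub>R f = r *\<^sub>R f + s *\<^sub>R f"
    "r *\<^sub>R s *\<^sub>R f = (r * s) *\<^sub>R f" "1 *\<^sub>R f = f"
    by (rule ell2_eqI, simp add: algebra_simps)+
  show "a *\<^sub>C (f + g) = a *\<^sub>C f + a *\<^sub>C g" "(a + b) *\<^sub>C f = a *\<^sub>C f + b *\<^sub>C f"
    "a *\<^sub>C b *\<^sub>C f = (a * b) *\<^sub>C f" "r *\<^sub>R f = complex_of_real r *\<^sub>C f"
    by (rule ell2_eqI, simp add: scaleC_add_right scaleC_add_left scaleC_scaleC scaleR_scaleC)+
  show "inner f g = inner g f"
    by (simp add: inner_ell2_def inner_commute)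
  show "inner (f + g) h = inner f h + inner g h"
    by (simp add: inner_ell2_def inner_add_left suminf_add summable_ell2_inner)
  show "inner (r *\<^sub>R f) g = r * inner f g"
    by (simp add: inner_ell2_def suminf_mult summable_ell2_inner)
  show "0 \<le> inner f f"
    by (simp add: inner_ell2_def suminf_nonneg summable_ell2_inner)
  show "inner f f = 0 \<longleftrightarrow> f = 0"
    by (auto simp: inner_ell2_def suminf_eq_zero_iff summable_ell2_inner intro: ell2_eqI)
  show "cinner f g = cnj (cinner g f)"
  proof -
    have "(\<lambda>n. cnj (cinner (ell2_nth g n) (ell2_nth f n))) sums cnj (cinner g f)"
      unfolding sums_cnj cinner_ell2_def by (rule summable_sums[OF summable_ell2_cinner])
    then show ?thesis
      unfolding cinner_commute[of "ell2_nth g _", symmetric]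
      using sums_unique cinner_commute[of "ell2_nth f _" "ell2_nth g _"]
      by (simp add: cinner_ell2_def sums_iff)
  qed
  show "cinner (f + g) h = cinner f h + cinner g h"
    by (simp add: cinner_ell2_def cinner_add_left suminf_add summable_ell2_cinner)
  show "cinner (a *\<^sub>C f) g = a * cinner f g"
    by (simp add: cinner_ell2_def cinner_scaleC_left suminf_mult summable_ell2_cinner)
  show "inner f g = Re (cinner f g)"
    by (simp add: inner_ell2_def cinner_ell2_def inner_eq_Re_cinner Re_suminf summable_ell2_cinner)
qed (fact norm_ell2_def sgn_ell2_def dist_ell2_def uniformity_ell2_def open_ell2_def)+

end

lemma norm_ell2_square: "(norm f)\<^sup>2 = (\<Sum>n. (norm (ell2_nth f n))\<^sup>2)"
  by (simp add: power2_norm_eq_inner inner_ell2_def)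

lemma sum_norm_ell2_le: "(\<Sum>i<k. (norm (ell2_nth f i))\<^sup>2) \<le> (norm f)\<^sup>2"
  unfolding norm_ell2_square by (rule sum_le_suminf[OF summable_ell2]) auto

lemma norm_ell2_nth_le: "norm (ell2_nth f n) \<le> norm f"
proof (rule power2_le_imp_le)
  have "(norm (ell2_nth f n))\<^sup>2 \<le> (\<Sum>i<Suc n. (norm (ell2_nth f i))\<^sup>2)"
    by (rule member_le_sum) auto
  then show "(norm (ell2_nth f n))\<^sup>2 \<le> (norm f)\<^sup>2"
    using sum_norm_ell2_le order_trans by blast
qed simp

instance ell2 :: (chilbert_space) chilbert_space
proof
  fix X :: "nat \<Rightarrow> 'a ell2"
  assume X: "Cauchy X"
  have "Cauchy (\<lambda>m. ell2_nth (X m) i)" for i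
  proof (rule CauchyI)
    fix e :: real
    assume "0 < e"
    then obtain M where "\<And>m n. m \<ge> M \<Longrightarrow> n \<ge> M \<Longrightarrow> norm (X m - X n) < e"
      using CauchyD[OF X] by blast
    then show "\<exists>M. \<forall>m\<ge>M. \<forall>n\<ge>M. norm (ell2_nth (X m) i - ell2_nth (X n) i) < e"
      by (metis ell2_nth_diff norm_ell2_nth_le order_le_less_trans)
  qed
  then have "\<exists>l. (\<lambda>m. ell2_nth (X m) i) \<longlonglongrightarrow> l" for i
    using Cauchy_convergent_iff convergent_def by blast
  then obtain l where l: "\<And>i. (\<lambda>m. ell2_nth (X m) i) \<longlonglongrightarrow> l i"
    by metis
  have bound: "\<exists>M. \<forall>m\<ge>M. \<forall>k. (\<Sum>i<k. (norm (ell2_nth (X m) i - l i))\<^sup>2) \<le> e\<^sup>2"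
    if e: "0 < e" for e :: real
  proof -
    obtain M where M: "\<And>m n. m \<ge> M \<Longrightarrow> n \<ge> M \<Longrightarrow> norm (X m - X n) < e"
      using CauchyD[OF X e] by blast
    have "(\<Sum>i<k. (norm (ell2_nth (X m) i - l i))\<^sup>2) \<le> e\<^sup>2" if "m \<ge> M" for m k
    proof (rule tendsto_upperbound)
      show "(\<lambda>n. \<Sum>i<k. (norm (ell2_nth (X m) i - ell2_nth (X n) i))\<^sup>2)
          \<longlonglongrightarrow> (\<Sum>i<k. (norm (ell2_nth (X m) i - l i))\<^sup>2)"
        by (intro tendsto_intros l)
      show "\<forall>\<^sub>F n in sequentially. (\<Sum>i<k. (norm (ell2_nth (X m) i - ell2_nth (X n) i))\<^sup>2) \<le> e\<^sup>2"
      proof (rule eventually_sequentiallyI)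
        fix n
        assume "M \<le> n"
        then have "norm (X m - X n) \<le> e"
          using M[OF that] by (simp add: less_imp_le)
        then have "(norm (X m - X n))\<^sup>2 \<le> e\<^sup>2"
          by (simp add: power_mono)
        then show "(\<Sum>i<k. (norm (ell2_nth (X m) i - ell2_nth (X n) i))\<^sup>2) \<le> e\<^sup>2"
          using sum_norm_ell2_le[of "X m - X n" k] by simp
      qed
    qed simp
    then show ?thesis
      by blast
  qed
  have summ: "summable (\<lambda>i. (norm (ell2_nth (X m) i - l i))\<^sup>2)"
    if "\<forall>k. (\<Sum>i<k. (norm (ell2_nth (X m) i - l i))\<^sup>2) \<le> e" for m e
    by (rule summableI_nonneg_bounded[where x = e]) (use that in auto)
  obtain M where "\<forall>k. (\<Sum>i<k. (norm (ell2_nth (X M) i - l i))\<^sup>2) \<le> 1\<^sup>2"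
    using bound[of 1] by auto
  from summ[OF this] have "summable (\<lambda>i. (norm (l i - ell2_nth (X M) i))\<^sup>2)"
    by (simp add: norm_minus_commute)
  from summable_norm_add_square[OF this summable_ell2[of "X M"]]
  have L: "ell2_nth (Abs_ell2 l) = l"
    by (simp add: ell2_nth_Abs)
  have "X \<longlonglongrightarrow> Abs_ell2 l"
  proof (rule LIMSEQ_I)
    fix e :: real
    assume e: "0 < e"
    then obtain M where M: "\<And>m k. m \<ge> M \<Longrightarrow>
        (\<Sum>i<k. (norm (ell2_nth (X m) i - l i))\<^sup>2) \<le> (e / 2)\<^sup>2"
      using bound[of "e / 2"] by auto
    have "norm (X m - Abs_ell2 l) < e" if "m \<ge> M" for m
    proof -
      have "(\<Sum>i. (norm (ell2_nth (X m) i - l i))\<^sup>2) \<le> (e / 2)\<^sup>2"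
        by (rule suminf_le_const[OF summ]) (use M[OF that] in auto)
      then have "(norm (X m - Abs_ell2 l))\<^sup>2 \<le> (e / 2)\<^sup>2"
        by (simp add: norm_ell2_square L)
      then have "norm (X m - Abs_ell2 l) \<le> e / 2"
        using e by (simp add: power2_le_iff_abs_le)
      then show ?thesis
        using e by simp
    qed
    then show "\<exists>M. \<forall>m\<ge>M. norm (X m - Abs_ell2 l) < e"
      by blast
  qed
  then show "convergent X"
    by (auto simp: convergent_def)
qed


section \<open>Operators\<close>

definition bounded_clinear :: "('a :: complex_inner \<Rightarrow> 'b :: complex_inner) \<Rightarrow> bool"
  where "bounded_clinear T \<longleftrightarrow> bounded_linear T \<and> (\<forall>a x. T (a *\<^sub>C x) = a *\<^sub>C T x)"

definition cadjoint :: "('a :: chilbert_space \<Rightarrow> 'b :: chilbert_space) \<Rightarrow> 'b \<Rightarrow> 'a"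
  where "cadjoint T = (THE S. \<forall>x y. cinner (T x) y = cinner x (S y))"

definition cspectrum :: "('a :: chilbert_space \<Rightarrow> 'a) \<Rightarrow> complex set"
  where "cspectrum T = {c. \<not> (\<exists>S. bounded_clinear S \<and>
    (\<forall>x. S (T x - c *\<^sub>C x) = x) \<and> (\<forall>x. T (S x) - c *\<^sub>C S x = x))}"

text \<open>
  The spectrum of a bounded operator is empty only on the zero space; inserting 0 fixes the value 0
  there and changes nothing otherwise.
\<close>

definition spectral_radius :: "('a :: chilbert_space \<Rightarrow> 'a) \<Rightarrow> real"
  where "spectral_radius T = Sup (insert 0 (cmod ` cspectrum T))"

definition m_defect :: "nat \<Rightarrow> ('a :: chilbert_space \<Rightarrow> 'a) \<Rightarrow> 'a \<Rightarrow> 'a"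
  where "m_defect m T x =
    (\<Sum>k=0..m. ((- 1) ^ (m - k) * real (m choose k)) *\<^sub>R (cadjoint T ^^ k) ((T ^^ k) x))"

definition m_isometry :: "nat \<Rightarrow> ('a :: chilbert_space \<Rightarrow> 'a) \<Rightarrow> bool"
  where "m_isometry m T \<longleftrightarrow> bounded_clinear T \<and> (\<forall>x. m_defect m T x = 0)"

definition m_partial_isometry :: "nat \<Rightarrow> ('a :: chilbert_space \<Rightarrow> 'a) \<Rightarrow> bool"
  where "m_partial_isometry m T \<longleftrightarrow> bounded_clinear T \<and> (\<forall>x. T (m_defect m T x) = 0)"

definition orthogonal_projection :: "'a :: chilbert_space set \<Rightarrow> 'a \<Rightarrow> 'a"
  where "orthogonal_projection M x = (THE y. y \<in> M \<and> (\<forall>z\<in>M. cinner (x - y) z = 0))"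

text \<open>
  The inclusion of \<open>\<H>\<close> into the dilation space \<open>\<K>\<close> is given by a linear map \<^term>\<open>J\<close> preserving
  inner products, so that \<open>\<H>\<close> is identified with the subspace \<^term>\<open>range J\<close>, which is closed
  because \<open>\<H>\<close> is complete.
\<close>

definition isometric_embedding :: "('a :: chilbert_space \<Rightarrow> 'b :: chilbert_space) \<Rightarrow> bool"
  where "isometric_embedding J \<longleftrightarrow>
    bounded_clinear J \<and> (\<forall>x y. cinner (J x) (J y) = cinner x y)"

definition m_isometric_dilation ::
    "nat \<Rightarrow> ('a :: chilbert_space \<Rightarrow> 'a) \<Rightarrow> ('a \<Rightarrow> 'b :: chilbert_space) \<Rightarrow> ('b \<Rightarrow> 'b) \<Rightarrow> bool"
  where "m_isometric_dilation m T J V \<longleftrightarrow>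
    isometric_embedding J \<and> m_isometry m V \<and>
    (\<forall>n x. J ((T ^^ n) x) = orthogonal_projection (range J) ((V ^^ n) (J x)))"

end

theory Submission
  imports Defs
begin

text \<open>
  (a) For an \<open>m'\<close>-isometry \<open>V\<close> the sequence \<open>n \<mapsto> \<parallel>V\<^sup>n x\<parallel>\<^sup>2\<close> has vanishing \<open>m'\<close>-th difference, so
  \<open>\<parallel>V\<^sup>n\<parallel>\<close>, and with it the norm of the compression \<open>T\<^sup>n\<close>, grows at most polynomially; the Neumann series
  then inverts \<open>T - c\<close> whenever \<open>\<bar>c\<bar> > 1\<close>.

  (b) The defect operator of a 3-partial isometry is \<open>- P\<close> with \<open>P\<close> the projection onto the kernel
  of \<open>T\<close>.  Hence \<open>n \<mapsto> \<parallel>T\<^sup>n x\<parallel>\<^sup>2\<close> has third difference \<open>- \<parallel>P T\<^sup>n x\<parallel>\<^sup>2 \<le> 0\<close>, so its second difference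
  stays nonnegative, and summing gives \<open>\<Sum>n. \<parallel>P T\<^sup>n x\<parallel>\<^sup>2 < \<infinity>\<close>.  Therefore \<open>x \<mapsto> (T x, (P T\<^sup>n x)\<^sub>n)\<close> is
  bounded, and following the sequence \<open>(P T\<^sup>n x)\<^sub>n\<close> by a suitable weighted shift compensates the
  third difference exactly.
\<close>

section \<open>Adjoints\<close>

text \<open>The representing vector minimises \<open>(norm u)\<^sup>2 - 2 * \<phi> u\<close>; minimising sequences are Cauchy
  by the parallelogram law.\<close>

lemma riesz_representation:
  fixes \<phi> :: "'a :: {real_inner, complete_space} \<Rightarrow> real"
  assumes "bounded_linear \<phi>"
  obtains u where "\<And>z. \<phi> z = inner z u"
proof -
  interpret bounded_linear \<phi> by fact
  obtain B where B: "\<And>x. norm (\<phi> x) \<le> norm x * B"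
    using bounded by blast
  define F where "F u = (norm u)\<^sup>2 - 2 * \<phi> u" for u
  have F_bound: "F u \<ge> - B\<^sup>2" for u
  proof -
    have "\<phi> u \<le> norm u * B"
      using B[of u] by simp
    then show ?thesis
      unfolding F_def using zero_le_power2[of "norm u - B"]
      by (simp add: power2_diff)
  qed
  then have bdd: "bdd_below (range F)"
    by (intro bdd_belowI2)
  define d where "d = Inf (range F)"
  have d: "d \<le> F u" for u
    unfolding d_def by (rule cInf_lower[OF _ bdd]) auto
  have "\<exists>u. F u < d + inverse (Suc n)" for n
    using cInf_lessD[of "range F" "d + inverse (Suc n)"] by (auto simp: d_def)
  then obtain X where X: "\<And>n. F (X n) < d + inverse (Suc n)"
    by metis
  have par: "(norm (u - v))\<^sup>2 = 2 * (F u + F v - 2 * F ((1/2) *\<^sub>R (u + v)))" for u v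
    unfolding F_def
    by (simp add: scaleR add power2_norm_eq_inner inner_diff_left inner_diff_right
        inner_add_left inner_add_right inner_commute field_simps)
  have dist_X: "(norm (X i - X j))\<^sup>2 \<le> 2 * (inverse (Suc i) + inverse (Suc j))" for i j
    unfolding par using X[of i] X[of j] d[of "(1/2) *\<^sub>R (X i + X j)"] by simp
  have "Cauchy X"
  proof (rule CauchyI)
    fix e :: real
    assume "0 < e"
    then obtain M where M: "inverse (real (Suc M)) < e\<^sup>2 / 4"
      using reals_Archimedean[of "e\<^sup>2 / 4"] by auto
    have "norm (X i - X j) < e" if "M \<le> i" "M \<le> j" for i j
    proof (rule power_less_imp_less_base)
      have "inverse (real (Suc i)) \<le> inverse (real (Suc M))"
        "inverse (real (Suc j)) \<le> inverse (real (Suc M))"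
        using that by (auto intro!: le_imp_inverse_le)
      then have "2 * (inverse (real (Suc i)) + inverse (real (Suc j))) < 2 * (e\<^sup>2 / 4 + e\<^sup>2 / 4)"
        using M by (intro mult_strict_left_mono add_strict_mono order_le_less_trans[OF _ M]) auto
      then show "(norm (X i - X j))\<^sup>2 < e\<^sup>2"
        using dist_X[of i j] by (simp del: of_nat_Suc)
    qed (use \<open>0 < e\<close> in simp)
    then show "\<exists>M. \<forall>m\<ge>M. \<forall>n\<ge>M. norm (X m - X n) < e"
      by blast
  qed
  then obtain u where u: "X \<longlonglongrightarrow> u"
    using Cauchy_convergent_iff convergent_def by blast
  have "(\<lambda>n. F (X n)) \<longlonglongrightarrow> F u"
    unfolding F_def by (intro tendsto_intros u tendsto)
  moreover have "(\<lambda>n. d + inverse (real (Suc n))) \<longlonglongrightarrow> d + 0"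
    by (intro tendsto_intros LIMSEQ_inverse_real_of_nat)
  ultimately have "F u \<le> d + 0"
    by (rule LIMSEQ_le) (use X less_imp_le in blast)
  then have min: "F u \<le> F v" for v
    using d[of v] by linarith
  show thesis
  proof
    fix z
    \<comment> \<open>\<open>b\<close> exceeds \<open>(norm z)^2\<close> by one, hence is positive
      even for \<open>z = 0\<close>. At \<open>t = - a / b\<close> the quadratic below takes the
      value \<open>- a^2 / b^2\<close>, which forces \<open>a = 0\<close>.\<close>
    define a b where "a = 2 * (inner z u - \<phi> z)" and "b = (norm z)\<^sup>2 + 1"
    have b: "b > 0"
      unfolding b_def by (simp add: add_nonneg_pos)
    have "0 \<le> t * a + t\<^sup>2 * (b - 1)" for t
      using min[of "u + t *\<^sub>R z"] unfolding F_def a_def b_def power2_norm_eq_inner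
      by (simp add: scaleR add inner_add_left inner_add_right
          inner_commute algebra_simps power2_eq_square)
    from this[of "- a / b"] have "0 \<le> - a\<^sup>2 / b\<^sup>2"
      using b by (simp add: field_simps power2_eq_square)
    then have "a\<^sup>2 \<le> 0"
      using b by (simp add: field_simps)
    then show "\<phi> z = inner z u"
      by (simp add: a_def)
  qed
qed

lemma bounded_clinear_scaleC: "bounded_clinear T \<Longrightarrow> T (a *\<^sub>C x) = a *\<^sub>C T x"
  by (simp add: bounded_clinear_def)

lemma bounded_clinear_linear: "bounded_clinear T \<Longrightarrow> linear T"
  by (simp add: bounded_clinear_def bounded_linear.linear)

text \<open>Multiplying the first argument by \<open>\<i>\<close> turns the imaginary part into
  minus a real part. Real Riesz representation thereby determines the complex form.\<close>

lemma cinner_eq_inner: "cinner x y = Complex (inner x y) (- inner (\<i> *\<^sub>C x) y)"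
  by (simp add: complex_eq_iff inner_eq_Re_cinner cinner_scaleC_left)

lemma cinner_eqI: "(\<And>x. cinner x y = cinner x z) \<Longrightarrow> y = z"
  by (rule vector_eq_ldot[THEN iffD1]) (simp add: inner_eq_Re_cinner)

lemma inner_scaleC_right: "inner x (a *\<^sub>C y) = inner (cnj a *\<^sub>C x) y"
  unfolding inner_eq_Re_cinner
  by (subst cinner_commute) (simp add: cinner_scaleC_left cinner_commute[of y x])

lemma cinner_diff_left: "cinner (x - y) z = cinner x z - cinner y z"
  using cinner_add_left[of "x - y" y z] by simp

text \<open>\<open>cadjoint\<close> is a definite description, so existence and uniqueness are both
  due. The real Riesz vector of \<open>z \<mapsto> inner (T z) y\<close> also represents the complex
  form because \<open>T\<close> commutes with \<open>\<i>\<close>.\<close>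

lemma cinner_cadjoint:
  fixes T :: "'a :: chilbert_space \<Rightarrow> 'b :: chilbert_space"
  assumes T: "bounded_clinear T"
  shows "cinner (T x) y = cinner x (cadjoint T y)"
proof -
  have "\<exists>u. \<forall>z. inner (T z) y = inner z u" for y
  proof -
    have "bounded_linear (\<lambda>z. inner (T z) y)"
      using T bounded_linear_compose[OF bounded_linear_inner_left, of T y]
      by (simp add: bounded_clinear_def)
    then obtain u where "\<And>z. inner (T z) y = inner z u"
      by (rule riesz_representation) blast
    then show ?thesis
      by blast
  qed
  then have "\<exists>S. \<forall>y z. inner (T z) y = inner z (S y)"
    by (intro choice allI)
  then obtain S where S: "\<And>y z. inner (T z) y = inner z (S y)"
    by blast
  have S': "\<forall>x y. cinner (T x) y = cinner x (S y)"
  proof (intro allI)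
    fix x y
    have "cinner (T x) y = Complex (inner (T x) y) (- inner (T (\<i> *\<^sub>C x)) y)"
      by (simp add: cinner_eq_inner bounded_clinear_scaleC[OF T])
    also have "\<dots> = cinner x (S y)"
      unfolding S by (rule cinner_eq_inner[symmetric])
    finally show "cinner (T x) y = cinner x (S y)" .
  qed
  have "cadjoint T = S"
    unfolding cadjoint_def
  proof (rule the_equality)
    show "\<forall>x y. cinner (T x) y = cinner x (S y)"
      by (fact S')
    show "R = S" if R: "\<forall>x y. cinner (T x) y = cinner x (R y)" for R
    proof (rule ext, rule cinner_eqI)
      show "cinner x (R y) = cinner x (S y)" for x y
        using R[rule_format, of x y] S'[rule_format, of x y] by (rule trans[OF sym])
    qed
  qed
  then show ?thesis
    using S'[rule_format, of x y] by (simp only:)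
qed

lemma inner_cadjoint:
  "bounded_clinear T \<Longrightarrow> inner (T x) y = inner x (cadjoint T y)"
  by (simp add: inner_eq_Re_cinner cinner_cadjoint)

lemma inner_cadjoint_funpow:
  fixes T :: "'a :: chilbert_space \<Rightarrow> 'a"
  shows "bounded_clinear T \<Longrightarrow> inner ((T ^^ k) x) y = inner x ((cadjoint T ^^ k) y)"
proof (induction k arbitrary: x y)
  case (Suc k)
  show ?case
    using Suc.prems by (simp add: Suc.IH inner_cadjoint) (simp add: funpow_swap1)
qed simp

lemma bounded_clinear_funpow:
  fixes T :: "'a :: complex_inner \<Rightarrow> 'a"
  shows "bounded_clinear T \<Longrightarrow> bounded_clinear (T ^^ k)"
proof (induction k)
  case (Suc k)
  then show ?case
    using bounded_linear_compose[of T "T ^^ k"] by (simp add: bounded_clinear_def o_def)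
qed (simp add: bounded_clinear_def bounded_linear_ident id_def)

section \<open>The defect operator as a symmetric form\<close>

lemma inner_m_defect:
  assumes "bounded_clinear T"
  shows "inner z (m_defect m T x) =
    (\<Sum>k=0..m. (- 1) ^ (m - k) * real (m choose k) * inner ((T ^^ k) z) ((T ^^ k) x))"
  by (simp add: m_defect_def inner_sum_right inner_cadjoint_funpow[OF assms])

lemma inner_m_defect_commute:
  "bounded_clinear T \<Longrightarrow> inner z (m_defect m T x) = inner (m_defect m T z) x"
  by (subst (2) inner_commute) (simp add: inner_m_defect inner_commute)

text \<open>Symmetry moves the defect operator onto the test vector, and additivity becomes that of
  the inner product.\<close>

lemma m_defect_add:
  assumes "bounded_clinear T"
  shows "m_defect m T (x + y) = m_defect m T x + m_defect m T y"
  by (rule vector_eq_ldot[THEN iffD1])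
    (simp add: inner_m_defect_commute[OF assms] inner_add_right)

lemma m_defect_scaleC:
  assumes "bounded_clinear T"
  shows "m_defect m T (a *\<^sub>C x) = a *\<^sub>C m_defect m T x"
proof (rule vector_eq_ldot[THEN iffD1], intro allI)
  fix z
  have "inner z (m_defect m T (a *\<^sub>C x)) = inner (cnj a *\<^sub>C z) (m_defect m T x)"
    unfolding inner_m_defect[OF assms]
    by (simp add: bounded_clinear_scaleC[OF bounded_clinear_funpow[OF assms]] inner_scaleC_right)
  then show "inner z (m_defect m T (a *\<^sub>C x)) = inner z (a *\<^sub>C m_defect m T x)"
    by (simp add: inner_scaleC_right)
qed

text \<open>By polarisation it suffices to test the quadratic form.\<close>

lemma m_isometryI:
  assumes T: "bounded_clinear T" and "\<And>x. inner x (m_defect m T x) = 0"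
  shows "m_isometry m T"
  unfolding m_isometry_def
proof (intro conjI allI)
  fix x
  let ?y = "m_defect m T x"
  have "inner (x + ?y) (m_defect m T (x + ?y)) = 2 * inner ?y ?y"
    by (simp add: m_defect_add[OF T] inner_add_left inner_add_right assms(2)
        inner_m_defect_commute[OF T, of x])
  then show "?y = 0"
    by (simp add: assms(2))
qed (fact T)

section \<open>Growth of the powers of an m-isometry\<close>

definition fdiff :: "(nat \<Rightarrow> real) \<Rightarrow> nat \<Rightarrow> real"
  where "fdiff g n = g (Suc n) - g n"

text \<open>Pascal's rule drives the induction. For \<open>g k = (norm ((T ^^ k) x))^2\<close> the
  right-hand side is the form of \<open>inner_m_defect\<close> at \<open>(T ^^ n) x\<close>.\<close>

lemma fdiff_funpow:
  "(fdiff ^^ m) g n = (\<Sum>k=0..m. (- 1) ^ (m - k) * real (m choose k) * g (n + k))"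
proof (induction m arbitrary: n)
  case (Suc m)
  define t where "t k = (- 1) ^ (m - k) * real (m choose k)" for k
  have shift: "(\<Sum>k=0..m. t k * g (Suc n + k)) = (\<Sum>k=1..Suc m. t (k - 1) * g (n + k))"
    by (rule sum.reindex_bij_witness[of _ "\<lambda>k. k - 1" Suc]) auto
  have "(fdiff ^^ Suc m) g n =
      (\<Sum>k=0..m. t k * g (Suc n + k)) - (\<Sum>k=0..m. t k * g (n + k))"
    using Suc.IH fdiff_def[of "(fdiff ^^ m) g" n] by (simp add: t_def)
  \<comment> \<open>The range may be extended because \<open>m choose Suc m = 0\<close>; both sums
    then run over \<open>1..Suc m\<close> up to one term.\<close>
  also have "(\<Sum>k=0..m. t k * g (n + k)) = (\<Sum>k=0..Suc m. t k * g (n + k))"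
    by (simp add: t_def)
  also have "\<dots> = t 0 * g n + (\<Sum>k=1..Suc m. t k * g (n + k))"
    by (subst sum.atLeast_Suc_atMost) auto
  finally have "(fdiff ^^ Suc m) g n =
      - t 0 * g n + (\<Sum>k=1..Suc m. (t (k - 1) - t k) * g (n + k))"
    unfolding shift by (simp add: left_diff_distrib sum_subtractf)
  also have "(\<Sum>k=1..Suc m. (t (k - 1) - t k) * g (n + k)) =
      (\<Sum>k=1..Suc m. (- 1) ^ (Suc m - k) * real (Suc m choose k) * g (n + k))"
  proof (rule sum.cong)
    fix k
    assume "k \<in> {1..Suc m}"
    then obtain l where l: "k = Suc l" "l \<le> m"
      by (cases k) auto
    have "t l - t (Suc l) = (- 1) ^ (m - l) * real (Suc m choose Suc l)"
    proof (cases "l = m")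
      case False
      with l have "m - l = Suc (m - Suc l)"
        by simp
      then show ?thesis
        by (simp add: t_def algebra_simps)
    qed (simp add: t_def)
    then show "(t (k - 1) - t k) * g (n + k) =
        (- 1) ^ (Suc m - k) * real (Suc m choose k) * g (n + k)"
      by (simp add: l)
  qed simp
  also have "- t 0 * g n + \<dots> =
      (\<Sum>k=0..Suc m. (- 1) ^ (Suc m - k) * real (Suc m choose k) * g (n + k))"
    by (subst (2) sum.atLeast_Suc_atMost) (auto simp: t_def)
  finally show ?case .
qed simp

text \<open>Passing to \<open>fdiff g\<close> lowers \<open>m\<close> by one and at most doubles the
  bound on the initial values; summing back up costs one factor \<open>n + 1\<close>.\<close>

lemma polynomial_growth:
  assumes "\<And>n. (fdiff ^^ m) g n = 0" and "\<And>k. k \<le> m \<Longrightarrow> \<bar>g k\<bar> \<le> K"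
  shows "\<bar>g n\<bar> \<le> K * 2 ^ m * (real n + 1) ^ m"
  using assms
proof (induction m arbitrary: g K n)
  case 0
  then show ?case
    using order_trans[OF abs_ge_zero 0(2)[of 0]] by simp
next
  case (Suc m)
  have K: "0 \<le> K"
    using order_trans[OF abs_ge_zero Suc.prems(2)[of 0]] by simp
  have step: "\<bar>fdiff g i\<bar> \<le> 2 * K * 2 ^ m * (real i + 1) ^ m" for i
  proof (rule Suc.IH)
    show "(fdiff ^^ m) (fdiff g) n = 0" for n
      using Suc.prems(1)[of n] by (simp add: funpow_swap1)
    show "\<bar>fdiff g k\<bar> \<le> 2 * K" if "k \<le> m" for k
      using Suc.prems(2)[of k] Suc.prems(2)[of "Suc k"] that by (simp add: fdiff_def)
  qed
  show ?case
  proof (induction n)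
    case 0
    have "K * 1 \<le> K * 2 ^ Suc m"
      by (rule mult_left_mono[OF _ K]) (rule one_le_power, simp)
    then show ?case
      using Suc.prems(2)[of 0] by simp
  next
    case (Suc n)
    have "\<bar>g (Suc n)\<bar> \<le> \<bar>g n\<bar> + \<bar>fdiff g n\<bar>"
      by (simp add: fdiff_def)
    also have "\<dots> \<le> K * 2 ^ Suc m * (real n + 1) ^ Suc m + K * 2 ^ Suc m * (real n + 1) ^ m"
      using Suc.IH step[of n] by simp
    also have "\<dots> = K * 2 ^ Suc m * ((real n + 1) ^ m * (real n + 2))"
      by (simp add: algebra_simps)
    also have "\<dots> \<le> K * 2 ^ Suc m * ((real n + 2) ^ m * (real n + 2))"
      using K by (intro mult_left_mono mult_right_mono power_mono) auto
    finally show ?case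
      by (simp add: algebra_simps)
  qed
qed

text \<open>The vanishing defect at \<open>(V ^^ n) x\<close> annihilates the \<open>m\<close>-th
  difference of the squared norms. The initial values are controlled by bounds for finitely many
  powers, so \<open>M\<close> is uniform in \<open>x\<close>.\<close>

lemma m_isometry_growth:
  assumes "m_isometry m V"
  obtains M where "0 \<le> M" "\<And>n x. (norm ((V ^^ n) x))\<^sup>2 \<le> M * (real n + 1) ^ m * (norm x)\<^sup>2"
proof -
  have V: "bounded_clinear V" and defect: "\<And>x. m_defect m V x = 0"
    using assms by (auto simp: m_isometry_def)
  have "\<exists>B\<ge>0. \<forall>x. norm ((V ^^ k) x) \<le> norm x * B" for k
    using bounded_linear.nonneg_bounded bounded_clinear_funpow[OF V, of k]
    by (auto simp: bounded_clinear_def)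
  then obtain B where B: "\<And>k. 0 \<le> B k" "\<And>k x. norm ((V ^^ k) x) \<le> norm x * B k"
    by metis
  define C where "C = (\<Sum>k\<le>m. (B k)\<^sup>2)"
  have C: "0 \<le> C"
    by (simp add: C_def sum_nonneg)
  show thesis
  proof
    show "0 \<le> C * 2 ^ m"
      using C by simp
    fix n x
    define g where "g k = (norm ((V ^^ k) x))\<^sup>2" for k
    have "(fdiff ^^ m) g n = 0" for n
      using inner_m_defect[OF V, of "(V ^^ n) x" m "(V ^^ n) x"] defect
      by (simp add: fdiff_funpow g_def power2_norm_eq_inner add.commute[of n] funpow_add)
    moreover have "\<bar>g k\<bar> \<le> C * (norm x)\<^sup>2" if "k \<le> m" for k
    proof -
      have "g k \<le> (norm x * B k)\<^sup>2"
        unfolding g_def by (intro power_mono B) simp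
      also have "\<dots> \<le> C * (norm x)\<^sup>2"
        using member_le_sum[of k "{..m}" "\<lambda>k. (B k)\<^sup>2"] that
        by (simp add: C_def power_mult_distrib mult.commute[of "(norm x)\<^sup>2"] mult_right_mono)
      finally show ?thesis
        by (simp add: g_def)
    qed
    ultimately have "\<bar>g n\<bar> \<le> C * (norm x)\<^sup>2 * 2 ^ m * (real n + 1) ^ m"
      by (rule polynomial_growth)
    then show "(norm ((V ^^ n) x))\<^sup>2 \<le> C * 2 ^ m * (real n + 1) ^ m * (norm x)\<^sup>2"
      by (simp add: g_def mult_ac)
  qed
qed

section \<open>Compressions and the spectral radius\<close>

lemma orthogonal_projection_eqI:
  assumes J: "isometric_embedding J" and "\<And>w. cinner (y - J z) (J w) = 0"
  shows "orthogonal_projection (range J) y = J z"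
  unfolding orthogonal_projection_def
proof (rule the_equality)
  show "J z \<in> range J \<and> (\<forall>w\<in>range J. cinner (y - J z) w = 0)"
    using assms(2) by auto
  fix v
  assume v: "v \<in> range J \<and> (\<forall>w\<in>range J. cinner (y - v) w = 0)"
  then obtain u where u: "v = J u"
    by blast
  have "linear J"
    using J by (simp add: isometric_embedding_def bounded_clinear_linear)
  then have "J (z - u) = (y - v) - (y - J z)"
    by (simp add: u linear_diff)
  then have "cinner (J (z - u)) (J (z - u)) = 0"
    using v assms(2) by (metis cinner_diff_left diff_zero rangeI)
  then have "z = u"
    by (metis J isometric_embedding_def cinner_self eq_iff_diff_eq_0 norm_eq_zero of_real_eq_0_iff
        power_eq_0_iff)
  then show "v = J z"
    by (simp add: u)
qed

lemma isometric_embedding_norm: "isometric_embedding J \<Longrightarrow> norm (J x) = norm x"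
  by (simp add: isometric_embedding_def norm_eq_sqrt_inner inner_eq_Re_cinner)

text \<open>The projection onto \<open>range J\<close> is \<open>J\<close> composed with its
  adjoint, and Cauchy-Schwarz shows that the adjoint is a contraction.\<close>

lemma norm_le_of_orthogonal_projection:
  assumes J: "isometric_embedding J" and "J z = orthogonal_projection (range J) y"
  shows "norm z \<le> norm y"
proof -
  have bJ: "bounded_clinear J"
    using J by (simp add: isometric_embedding_def)
  have "orthogonal_projection (range J) y = J (cadjoint J y)"
  proof (rule orthogonal_projection_eqI[OF J])
    fix w
    have "cinner y (J w) = cinner (J (cadjoint J y)) (J w)"
      using J cinner_cadjoint[OF bJ, of w y] cinner_commute
      unfolding isometric_embedding_def by metis
    then show "cinner (y - J (cadjoint J y)) (J w) = 0"
      by (simp add: cinner_diff_left)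
  qed
  then have z: "norm z = norm (cadjoint J y)"
    using assms by (metis isometric_embedding_norm)
  have "(norm (cadjoint J y))\<^sup>2 = inner (J (cadjoint J y)) y"
    by (simp add: power2_norm_eq_inner inner_cadjoint[OF bJ])
  also have "\<dots> \<le> norm (cadjoint J y) * norm y"
    using norm_cauchy_schwarz isometric_embedding_norm[OF J] by metis
  finally show ?thesis
    unfolding z by (cases "cadjoint J y = 0") (auto simp: power2_eq_square)
qed

text \<open>Termwise differentiation of the power series with coefficients \<open>n ^ d\<close>
  gives coefficients \<open>(n + 1) ^ (d + 1)\<close>; a factor \<open>x\<close> realigns the
  exponents.\<close>

lemma summable_power_mult_geometric:
  fixes x :: real
  assumes "\<bar>x\<bar> < 1"
  shows "summable (\<lambda>n. real n ^ d * x ^ n)"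
  using assms
proof (induction d arbitrary: x)
  case 0
  then show ?case
    by (simp add: summable_geometric)
next
  case (Suc d)
  have "summable (\<lambda>n. diffs (\<lambda>n. real n ^ d) n * x ^ n)"
    using Suc by (intro termdiff_converges[where K = 1]) auto
  then have "summable (\<lambda>n. x * (diffs (\<lambda>n. real n ^ d) n * x ^ n))"
    by (rule summable_mult)
  then have "summable (\<lambda>n. real (Suc n) ^ Suc d * x ^ Suc n)"
    by (simp add: diffs_def mult_ac)
  then show ?case
    by (subst (asm) summable_Suc_iff)
qed

text \<open>For \<open>cmod c > 1\<close> geometric decay beats polynomial growth, so the Neumann
  series \<open>S\<close> of the inverse of \<open>T - c\<close> converges absolutely, with a bound
  linear in \<open>norm x\<close>.\<close>

lemma spectral_radius_le_one:
  fixes T :: "'a :: chilbert_space \<Rightarrow> 'a"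
  assumes T: "bounded_clinear T" and M: "0 \<le> M"
    and growth: "\<And>n x. norm ((T ^^ n) x) \<le> M * (real n + 1) ^ d * norm x"
  shows "spectral_radius T \<le> 1"
proof -
  have "cmod c \<le> 1" if "c \<in> cspectrum T" for c
  proof (rule ccontr)
    assume "\<not> cmod c \<le> 1"
    then have c: "1 < cmod c" "c \<noteq> 0"
      by auto
    define \<rho> where "\<rho> = inverse (cmod c)"
    have \<rho>: "0 < \<rho>" "\<rho> < 1"
      using c by (auto simp: \<rho>_def inverse_less_1_iff)
    define t where "t x n = (- (inverse c ^ Suc n)) *\<^sub>C (T ^^ n) x" for x n
    define b where "b n = \<rho> ^ Suc n * (M * (real n + 1) ^ d)" for n
    have t_le: "norm (t x n) \<le> b n * norm x" for x n
    proof -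
      have "norm (t x n) = \<rho> ^ Suc n * norm ((T ^^ n) x)"
        by (simp add: t_def norm_scaleC norm_mult norm_power norm_inverse \<rho>_def)
      also have "\<dots> \<le> \<rho> ^ Suc n * (M * (real n + 1) ^ d * norm x)"
        using \<rho> by (intro mult_left_mono growth) auto
      finally show ?thesis
        by (simp add: b_def mult_ac)
    qed
    have "summable (\<lambda>n. real (Suc n) ^ d * \<rho> ^ Suc n)"
      using summable_power_mult_geometric[of \<rho> d] \<rho> by (subst summable_Suc_iff) simp
    then have sb: "summable b"
      using summable_mult[of "\<lambda>n. real (Suc n) ^ d * \<rho> ^ Suc n" M]
      by (simp add: b_def[abs_def] mult_ac add.commute)
    have st: "summable (t x)" for x
      by (rule summable_comparison_test'[OF summable_mult2[OF sb]]) (rule t_le)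
    define S where "S x = (\<Sum>n. t x n)" for x
    have lin: "linear T"
      using T by (rule bounded_clinear_linear)
    have linn: "linear (T ^^ n)" for n
      using bounded_clinear_funpow[OF T] by (rule bounded_clinear_linear)
    have Tt: "T (t x n) = t (T x) n" for x n
      by (simp add: t_def bounded_clinear_scaleC[OF T] funpow_swap1)
    \<comment> \<open>Applying \<open>T\<close> advances the series by one index, up to the factor
      \<open>c\<close>. The head \<open>t x 0\<close> that is lost in this way produces the identity
      in \<open>ST\<close>.\<close>
    have tT: "t (T x) n = c *\<^sub>C t x (Suc n)" for x n
      using c by (simp add: t_def scaleC_scaleC funpow_swap1 mult.assoc[symmetric])
    have bl_scaleC: "bounded_linear (\<lambda>x :: 'a. a *\<^sub>C x)" for a
    proof (rule bounded_linear_intro)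
      show "a *\<^sub>C r *\<^sub>R x = r *\<^sub>R a *\<^sub>C x" for r and x :: 'a
        by (simp add: scaleR_scaleC scaleC_scaleC mult.commute)
      show "norm (a *\<^sub>C x) \<le> norm x * cmod a" for x :: 'a
        by (simp add: norm_scaleC)
    qed (simp add: scaleC_add_right)
    have S_scaleC: "S (a *\<^sub>C x) = a *\<^sub>C S x" for a x
    proof -
      have "t (a *\<^sub>C x) = (\<lambda>n. a *\<^sub>C t x n)"
        by (simp add: fun_eq_iff t_def bounded_clinear_scaleC[OF bounded_clinear_funpow[OF T]]
            scaleC_scaleC mult.commute)
      then show ?thesis
        unfolding S_def by (simp add: bounded_linear.suminf[OF bl_scaleC st])
    qed
    have S: "bounded_clinear S"
      unfolding bounded_clinear_def
    proof (intro conjI allI)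
      show "bounded_linear S"
      proof (rule bounded_linear_intro)
        fix x y
        have "t (x + y) = (\<lambda>n. t x n + t y n)"
          by (simp add: fun_eq_iff t_def linear_add[OF linn] scaleC_add_right)
        then show "S (x + y) = S x + S y"
          unfolding S_def by (simp add: suminf_add st)
        show "S (r *\<^sub>R x) = r *\<^sub>R S x" for r
          by (simp add: scaleR_scaleC S_scaleC)
        have "norm (S x) \<le> (\<Sum>n. b n * norm x)"
          unfolding S_def by (rule norm_suminf_le[OF t_le summable_mult2[OF sb]])
        then show "norm (S x) \<le> norm x * suminf b"
          by (simp add: suminf_mult2[OF sb, symmetric] mult.commute[of "norm x"])
      qed
    qed (fact S_scaleC)
    have ST: "S (T x) = c *\<^sub>C S x + x" for x
    proof -
      have x: "c *\<^sub>C t x 0 = - x"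
        using c scaleR_scaleC[of "- 1" x] by (simp add: t_def scaleC_scaleC)
      have "S (T x) = c *\<^sub>C (\<Sum>n. t x (Suc n))"
        using st[of x] unfolding S_def tT
        by (subst bounded_linear.suminf[OF bl_scaleC]) (simp_all add: summable_Suc_iff)
      also have "(\<Sum>n. t x (Suc n)) = S x - t x 0"
        unfolding S_def by (rule suminf_split_head[OF st])
      also have "c *\<^sub>C \<dots> = c *\<^sub>C S x - c *\<^sub>C t x 0"
        by (rule linear_diff[OF bounded_linear.linear[OF bl_scaleC]])
      finally show ?thesis
        by (simp add: x)
    qed
    have TS: "T (S x) = S (T x)" for x
      unfolding S_def using T st Tt
      by (subst bounded_linear.suminf[of T]) (auto simp: bounded_clinear_def)
    have "S (T x - c *\<^sub>C x) = x" "T (S x) - c *\<^sub>C S x = x" for x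
      using ST by (simp_all add: linear_diff[OF bounded_clinear_linear[OF S]] S_scaleC TS)
    with S have "c \<notin> cspectrum T"
      by (auto simp: cspectrum_def)
    then show False
      using that by blast
  qed
  \<comment> \<open>The inserted \<open>0\<close> makes the set nonempty and also obeys the
    bound.\<close>
  then show ?thesis
    unfolding spectral_radius_def by (intro cSup_least) auto
qed

lemma m_isometric_dilation_spectral_radius:
  assumes T: "bounded_clinear T" and "m_isometric_dilation m T J V"
  shows "spectral_radius T \<le> 1"
proof -
  have J: "isometric_embedding J" and V: "m_isometry m V"
    and dil: "\<And>n x. J ((T ^^ n) x) = orthogonal_projection (range J) ((V ^^ n) (J x))"
    using assms(2) by (auto simp: m_isometric_dilation_def)
  obtain M where M: "0 \<le> M" "\<And>n x. (norm ((V ^^ n) x))\<^sup>2 \<le> M * (real n + 1) ^ m * (norm x)\<^sup>2"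
    using m_isometry_growth[OF V] by blast
  have "norm ((T ^^ n) x) \<le> sqrt M * (real n + 1) ^ m * norm x" for n x
  proof -
    have "(norm ((T ^^ n) x))\<^sup>2 \<le> (norm ((V ^^ n) (J x)))\<^sup>2"
      using norm_le_of_orthogonal_projection[OF J dil] by (simp add: power_mono)
    also have "\<dots> \<le> M * (real n + 1) ^ m * (norm x)\<^sup>2"
      using M(2)[of n "J x"] by (simp add: isometric_embedding_norm[OF J])
    \<comment> \<open>Enlarging the polynomial factor to its square makes the whole bound a perfect
      square.\<close>
    also have "\<dots> \<le> M * ((real n + 1) ^ m)\<^sup>2 * (norm x)\<^sup>2"
      using M(1) by (intro mult_right_mono mult_left_mono self_le_power one_le_power) auto
    also have "\<dots> = (sqrt M * (real n + 1) ^ m * norm x)\<^sup>2"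
      using M(1) by (simp add: power_mult_distrib)
    finally show ?thesis
      by (rule power2_le_imp_le) (simp add: M(1))
  qed
  then show ?thesis
    using spectral_radius_le_one[OF T, of "sqrt M" m] M(1) by simp
qed

section \<open>The 3-isometric lifting of a 3-partial isometry\<close>

text \<open>From \<open>M\<close> on the sequence lies below a line of slope \<open>c\<close>. As
  \<open>B\<close> is arbitrary, a conclusion about \<open>fdiff g\<close> can feed a second
  application to \<open>g\<close> itself.\<close>

lemma fdiff_negative_unbounded:
  assumes "c < 0" and le: "\<And>n. M \<le> n \<Longrightarrow> fdiff h n \<le> c"
  shows "\<exists>N. \<forall>n\<ge>N. h n \<le> B"
proof -
  have bound: "h (M + k) \<le> h M + real k * c" for k
  proof (induction k)
    case (Suc k)
    then show ?case
      using le[of "M + k"] by (simp add: fdiff_def algebra_simps)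
  qed simp
  obtain K where "h M - B < real K * (- c)"
    using ex_less_of_nat_mult[of "- c" "h M - B"] \<open>c < 0\<close> by auto
  then have K: "h M + real K * c \<le> B"
    by simp
  have "h n \<le> B" if n: "M + K \<le> n" for n
  proof -
    have "h n \<le> h M + real (n - M) * c"
      using bound[of "n - M"] n by simp
    also have "\<dots> \<le> h M + real K * c"
      using n \<open>c < 0\<close> by (intro add_left_mono mult_right_mono_neg) auto
    finally show ?thesis
      using K by simp
  qed
  then show ?thesis
    by blast
qed

text \<open>A nonnegative sequence whose second difference is nonincreasing is convex: otherwise it would
  eventually lie below a parabola opening downwards.\<close>

lemma second_difference_nonneg:
  assumes "\<And>n. 0 \<le> g n" and "\<And>n. (fdiff ^^ 3) g n \<le> 0"
  shows "0 \<le> (fdiff ^^ 2) g n"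
proof (rule ccontr)
  define c where "c = (fdiff ^^ 2) g n"
  assume "\<not> 0 \<le> (fdiff ^^ 2) g n"
  then have c: "c < 0"
    by (simp add: c_def)
  have "fdiff (fdiff g) (Suc k) \<le> fdiff (fdiff g) k" for k
    using assms(2)[of k] fdiff_def[of "fdiff (fdiff g)" k] by (simp add: eval_nat_numeral)
  then have "fdiff (fdiff g) k \<le> c" if "n \<le> k" for k
    using lift_Suc_antimono_le[of "fdiff (fdiff g)" n k] that
    by (simp add: c_def eval_nat_numeral)
  from fdiff_negative_unbounded[OF c this] obtain M where "\<forall>k\<ge>M. fdiff g k \<le> - 1"
    by blast
  then obtain N where "\<forall>k\<ge>N. g k \<le> - 1"
    using fdiff_negative_unbounded[of "- 1" M g "- 1"] by auto
  then show False
    using assms(1)[of N] by force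
qed

text \<open>Splits a sum over all coordinates into coordinate \<open>0\<close> and, through the
  bijection \<open>prod_encode\<close>, the coordinates indexed by pairs.\<close>

lemma has_sum_nat_pairs:
  fixes h :: "nat \<Rightarrow> real"
  assumes "((\<lambda>(n, j). h (Suc (prod_encode (n, j)))) has_sum b) UNIV"
  shows "(h has_sum h 0 + b) UNIV"
proof -
  have "((\<lambda>p. h (Suc (prod_encode p))) has_sum b) UNIV"
    using assms by (simp add: case_prod_unfold)
  then have "((\<lambda>k. h (Suc k)) has_sum b) UNIV"
    using has_sum_reindex_bij_betw[OF bij_prod_encode, of "\<lambda>k. h (Suc k)"] by simp
  then have "(h has_sum b) (range Suc)"
    by (subst has_sum_reindex) (auto simp: o_def)
  moreover have "(h has_sum h 0) {0}"
    by (rule has_sum_finiteI) auto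
  ultimately have "(h has_sum h 0 + b) ({0} \<union> range Suc)"
    by (intro has_sum_Un_disjoint) auto
  then show ?thesis
    using UNIV_nat_eq by simp
qed

text \<open>In a lifted vector the column \<open>j = 0\<close> holds the new defect entries and the
  columns \<open>Suc j\<close> hold the shifted old ones.\<close>

lemma has_sum_split_first_column:
  fixes g :: "nat \<times> nat \<Rightarrow> real"
  assumes "((\<lambda>n. g (n, 0)) has_sum a) UNIV" and "((\<lambda>(n, j). g (n, Suc j)) has_sum b) UNIV"
  shows "(g has_sum a + b) UNIV"
proof -
  have "(g has_sum a) (range (\<lambda>n. (n, 0)))"
    using assms(1) by (subst has_sum_reindex) (auto simp: o_def inj_on_def)
  moreover have "(g has_sum b) (range (\<lambda>(n, j). (n, Suc j)))"
    using assms(2) by (subst has_sum_reindex) (auto simp: o_def inj_on_def case_prod_unfold)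
  ultimately have "(g has_sum a + b) (range (\<lambda>n. (n, 0)) \<union> range (\<lambda>(n, j). (n, Suc j)))"
    by (rule has_sum_Un_disjoint) auto
  moreover have "(n, j) \<in> range (\<lambda>n. (n, 0)) \<union> range (\<lambda>(n, j). (n, Suc j))" for n j :: nat
    by (cases j) force+
  ultimately show ?thesis
    by (metis UNIV_eq_I surj_pair)
qed

text \<open>The squared weights of the lifting.  For fixed \<open>n\<close> they are a polynomial of degree at most 2
  in \<open>j\<close>, which makes the weighted shift along \<open>j\<close> a 3-isometry; the exceptional row \<open>n = 1\<close>
  comes from \<open>(1 - z)\<^sup>2 * (\<Sum>n. z ^ n) + z = 1\<close>, the generating function identity behind the
  cancellation in \<open>third_difference_lifting\<close>.\<close>

definition weight :: "nat \<Rightarrow> nat \<Rightarrow> real"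
  where "weight n j = 1 + (if n = 1 then real j * (real j - 1) / 2 else 0)"

lemma weight_0 [simp]: "weight n 0 = 1"
  by (simp add: weight_def)

lemma weight_pos [simp]: "0 < weight n j"
proof -
  have "0 \<le> real j * (real j - 1)"
    by (cases j) auto
  then show ?thesis
    by (simp add: weight_def add_pos_nonneg)
qed

lemma weight_nonneg [simp]: "0 \<le> weight n j" and weight_neq_0 [simp]: "weight n j \<noteq> 0"
  using weight_pos[of n j] by linarith+

text \<open>The right side minus the left is \<open>1 + (j - 1)^2\<close> in the row
  \<open>n = 1\<close> and \<open>2\<close> in every other row. This bounds the shift.\<close>

lemma weight_Suc_le: "weight n (Suc j) \<le> 3 * weight n j"
  using zero_le_power2[of "real j - 1"]
  by (auto simp: weight_def power2_eq_square field_simps)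

lemma weight_add_le: "weight n (j + k) \<le> 3 ^ k * weight n j"
proof (induction k)
  case (Suc k)
  then show ?case
    using weight_Suc_le[of n "j + k"] by simp
qed simp

lemma weight_third_difference:
  "weight n (j + 3) - 3 * weight n (j + 2) + 3 * weight n (j + 1) - weight n j = 0"
  by (simp add: weight_def field_simps)

text \<open>Coordinate 0 of the sequence space carries the given space and coordinate
  \<open>Suc (prod_encode (n, j))\<close> the copy indexed by \<open>(n, j)\<close>.\<close>

definition lifting_nth :: "('a :: chilbert_space \<Rightarrow> 'a) \<Rightarrow> 'a ell2 \<Rightarrow> nat \<Rightarrow> 'a"
  where "lifting_nth T f i = (case i of
      0 \<Rightarrow> T (ell2_nth f 0)
    | Suc k \<Rightarrow> (case prod_decode k of
        (n, 0) \<Rightarrow> m_defect 3 T ((T ^^ n) (ell2_nth f 0))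
      | (n, Suc j) \<Rightarrow>
          sqrt (weight n (Suc j) / weight n j) *\<^sub>R ell2_nth f (Suc (prod_encode (n, j)))))"

lemma lifting_nth_simps [simp]:
  "lifting_nth T f 0 = T (ell2_nth f 0)"
  "lifting_nth T f (Suc (prod_encode (n, 0))) = m_defect 3 T ((T ^^ n) (ell2_nth f 0))"
  "lifting_nth T f (Suc (prod_encode (n, Suc j))) =
    sqrt (weight n (Suc j) / weight n j) *\<^sub>R ell2_nth f (Suc (prod_encode (n, j)))"
  by (simp_all add: lifting_nth_def)

lemma lifting_index_cases:
  obtains "i = 0" | n where "i = Suc (prod_encode (n, 0))"
  | n j where "i = Suc (prod_encode (n, Suc j))"
  by (metis nat.exhaust prod_decode_inverse surj_pair)

definition lifting :: "('a :: chilbert_space \<Rightarrow> 'a) \<Rightarrow> 'a ell2 \<Rightarrow> 'a ell2"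
  where "lifting T f = Abs_ell2 (lifting_nth T f)"

text \<open>Over \<open>k\<close> steps the shift factors telescope to
  \<open>weight n (j + k) / weight n j\<close>, so this is the squared norm of the pair coordinates
  after \<open>k\<close> shifts.\<close>

definition weighted_sum :: "nat \<Rightarrow> 'a :: chilbert_space ell2 \<Rightarrow> real"
  where "weighted_sum k f = (\<Sum>\<^sub>\<infinity>(n, j).
    weight n (j + k) / weight n j * (norm (ell2_nth f (Suc (prod_encode (n, j)))))\<^sup>2)"

lemma summable_on_ell2_pairs:
  "(\<lambda>(n, j). (norm (ell2_nth f (Suc (prod_encode (n, j)))))\<^sup>2) summable_on UNIV"
proof -
  have "(\<lambda>i. (norm (ell2_nth f i))\<^sup>2) summable_on UNIV"
    by (rule summable_nonneg_imp_summable_on[OF summable_ell2]) simp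
  then have "(\<lambda>i. (norm (ell2_nth f i))\<^sup>2) summable_on range (\<lambda>p. Suc (prod_encode p))"
    by (rule summable_on_subset) simp
  then show ?thesis
    by (subst (asm) summable_on_reindex)
      (auto simp: o_def case_prod_unfold inj_on_def prod_encode_eq)
qed

lemma weighted_sum_has_sum:
  "((\<lambda>(n, j). weight n (j + k) / weight n j *
      (norm (ell2_nth f (Suc (prod_encode (n, j)))))\<^sup>2) has_sum weighted_sum k f) UNIV"
  unfolding weighted_sum_def
proof (rule has_sum_infsum, rule summable_on_comparison_test)
  show "(\<lambda>p. 3 ^ k * (case p of (n, j) \<Rightarrow> (norm (ell2_nth f (Suc (prod_encode (n, j)))))\<^sup>2))
      summable_on UNIV"
    by (intro summable_on_cmult_right summable_on_ell2_pairs)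
  fix p :: "nat \<times> nat"
  obtain n j where p: "p = (n, j)"
    by fastforce
  have "weight n (j + k) / weight n j \<le> 3 ^ k"
    using weight_add_le[of n j k] by (simp add: divide_le_eq)
  then show "(case p of (n, j) \<Rightarrow>
      weight n (j + k) / weight n j * (norm (ell2_nth f (Suc (prod_encode (n, j)))))\<^sup>2)
      \<le> 3 ^ k * (case p of (n, j) \<Rightarrow> (norm (ell2_nth f (Suc (prod_encode (n, j)))))\<^sup>2)"
    unfolding p prod.case by (rule mult_right_mono) simp
qed auto

lemma norm_eq_weighted_sum: "(norm f)\<^sup>2 = (norm (ell2_nth f 0))\<^sup>2 + weighted_sum 0 f"
proof -
  have "((\<lambda>i. (norm (ell2_nth f i))\<^sup>2) has_sum (norm (ell2_nth f 0))\<^sup>2 + weighted_sum 0 f) UNIV"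
    using weighted_sum_has_sum[of 0 f] by (intro has_sum_nat_pairs) simp
  then show ?thesis
    unfolding norm_ell2_square by (intro sums_unique[symmetric] has_sum_imp_sums)
qed

text \<open>The cancellation takes place coordinate by coordinate, by
  \<open>weight_third_difference\<close>.\<close>

lemma weighted_sum_third_difference:
  "weighted_sum 3 f - 3 * weighted_sum 2 f + 3 * weighted_sum 1 f - weighted_sum 0 f = 0"
proof -
  let ?e = "\<lambda>k (n, j). weight n (j + k) / weight n j *
      (norm (ell2_nth f (Suc (prod_encode (n, j)))))\<^sup>2"
  have sum: "((\<lambda>p. ?e 3 p + - 3 * ?e 2 p + 3 * ?e 1 p + - 1 * ?e 0 p) has_sum
      weighted_sum 3 f + - 3 * weighted_sum 2 f + 3 * weighted_sum 1 f + - 1 * weighted_sum 0 f)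
      UNIV"
    by (intro has_sum_add has_sum_cmult_right weighted_sum_has_sum)
  have zero: "?e 3 p + - 3 * ?e 2 p + 3 * ?e 1 p + - 1 * ?e 0 p = 0" for p
  proof -
    obtain n j where p: "p = (n, j)"
      by fastforce
    have "?e 3 p + - 3 * ?e 2 p + 3 * ?e 1 p + - 1 * ?e 0 p =
        (weight n (j + 3) - 3 * weight n (j + 2) + 3 * weight n (j + 1) - weight n j) /
        weight n j * (norm (ell2_nth f (Suc (prod_encode (n, j)))))\<^sup>2"
      unfolding p by (simp add: field_simps)
    then show ?thesis
      by (simp only: weight_third_difference div_0 mult_zero_left)
  qed
  show ?thesis
    using has_sum_unique[OF sum[unfolded zero] has_sum_0] by simp
qed

section \<open>Defects along the orbits of a 3-partial isometry\<close>

locale three_partial_isometry =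
  fixes T :: "'a :: chilbert_space \<Rightarrow> 'a"
  assumes m_partial_isometry_3: "m_partial_isometry 3 T"
begin

abbreviation defect :: "'a \<Rightarrow> 'a"
  where "defect \<equiv> m_defect 3 T"

lemma bounded_clinear: "bounded_clinear T" and T_defect: "T (defect x) = 0"
  using m_partial_isometry_3 by (auto simp: m_partial_isometry_def)

lemma linear: "linear T"
  by (rule bounded_clinear_linear[OF bounded_clinear])

text \<open>Since \<open>T\<close> kills the range of the defect operator, only the term \<open>k = 0\<close> survives there, so
  that \<open>- defect\<close> is the orthogonal projection onto the kernel of \<open>T\<close>.\<close>

lemma inner_defect_self: "inner x (defect x) = - (norm (defect x))\<^sup>2"
proof -
  have "(T ^^ Suc k) (defect x) = 0" for k
    by (induction k) (simp_all add: T_defect linear_0[OF linear])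
  then have T_pow: "(T ^^ k) (defect x) = 0" if "0 < k" for k
    using that by (metis gr0_implies_Suc)
  have "inner (defect x) (defect x) =
      (\<Sum>k=0..3. (- 1) ^ (3 - k) * real (3 choose k) * inner ((T ^^ k) (defect x)) ((T ^^ k) x))"
    by (rule inner_m_defect[OF bounded_clinear])
  also have "\<dots> = (\<Sum>k=0..(3 :: nat). if k = 0 then - inner (defect x) x else 0)"
    by (intro sum.cong) (auto simp: T_pow)
  finally show ?thesis
    by (simp add: power2_norm_eq_inner inner_commute)
qed

lemma fdiff3_norm_powers:
  "(fdiff ^^ 3) (\<lambda>k. (norm ((T ^^ k) x))\<^sup>2) n = - (norm (defect ((T ^^ n) x)))\<^sup>2"
  unfolding inner_defect_self[symmetric] inner_m_defect[OF bounded_clinear] fdiff_funpow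
  by (simp add: power2_norm_eq_inner add.commute[of n] funpow_add)

lemma third_difference_norm:
  "(norm (T (T (T x))))\<^sup>2 - 3 * (norm (T (T x)))\<^sup>2 + 3 * (norm (T x))\<^sup>2 - (norm x)\<^sup>2 =
    - (norm (defect x))\<^sup>2"
  using fdiff3_norm_powers[of x 0] by (simp add: eval_nat_numeral fdiff_def)

text \<open>The defects are negated third differences, so the sum telescopes to second differences
  at \<open>0\<close> and \<open>N\<close>; the one at \<open>N\<close> is nonnegative. The bound is
  uniform in \<open>N\<close>, which makes the lifting bounded.\<close>

lemma sum_defect_le:
  "(\<Sum>n<N. (norm (defect ((T ^^ n) x)))\<^sup>2) \<le> (norm (T (T x)))\<^sup>2 + (norm x)\<^sup>2"
proof -
  define g where "g = (\<lambda>k. (norm ((T ^^ k) x))\<^sup>2)"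
  have "(\<Sum>n<N. (norm (defect ((T ^^ n) x)))\<^sup>2) = (fdiff ^^ 2) g 0 - (fdiff ^^ 2) g N"
  proof (induction N)
    case (Suc N)
    have "(fdiff ^^ 3) g N = (fdiff ^^ 2) g (Suc N) - (fdiff ^^ 2) g N"
      by (simp add: eval_nat_numeral fdiff_def)
    then show ?case
      using Suc fdiff3_norm_powers[of x N] by (simp add: g_def)
  qed simp
  also have "0 \<le> (fdiff ^^ 2) g N"
    by (rule second_difference_nonneg) (simp_all add: g_def fdiff3_norm_powers)
  then have "(fdiff ^^ 2) g 0 - (fdiff ^^ 2) g N \<le> (fdiff ^^ 2) g 0"
    by simp
  \<comment> \<open>The discarded middle term of the second difference is
    \<open>- 2 * (norm (T x))^2\<close>.\<close>
  also have "\<dots> \<le> (norm (T (T x)))\<^sup>2 + (norm x)\<^sup>2"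
    by (simp add: g_def eval_nat_numeral fdiff_def)
  finally show ?thesis .
qed

text \<open>The squared norm, after \<open>k\<close> shifts, of the entries that one lifting step
  places in column \<open>0\<close>; there the weight quotient is \<open>weight n k\<close> because
  \<open>weight n 0 = 1\<close>.\<close>

definition defect_sum :: "nat \<Rightarrow> 'a \<Rightarrow> real"
  where "defect_sum k x = (\<Sum>n. weight n k * (norm (defect ((T ^^ n) x)))\<^sup>2)"

lemma summable_defect: "summable (\<lambda>n. (norm (defect ((T ^^ n) x)))\<^sup>2)"
  by (rule summableI_nonneg_bounded[OF _ sum_defect_le]) simp

lemma summable_weight_defect: "summable (\<lambda>n. weight n k * (norm (defect ((T ^^ n) x)))\<^sup>2)"
proof (rule summable_comparison_test'[OF summable_mult[OF summable_defect, of "3 ^ k"]])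
  show "norm (weight n k * (norm (defect ((T ^^ n) x)))\<^sup>2) \<le>
      3 ^ k * (norm (defect ((T ^^ n) x)))\<^sup>2" for n
    using weight_add_le[of n 0 k] by (simp add: abs_mult mult_right_mono)
qed

lemma defect_sum_0_le: "defect_sum 0 x \<le> (norm (T (T x)))\<^sup>2 + (norm x)\<^sup>2"
  using suminf_le_const[OF summable_defect sum_defect_le] by (simp add: defect_sum_def)

lemma defect_sum_T: "defect_sum 0 x = (norm (defect x))\<^sup>2 + defect_sum 0 (T x)"
  using suminf_split_head[OF summable_defect[of x]] by (simp add: defect_sum_def funpow_swap1)

lemma defect_sum_1: "defect_sum 1 x = defect_sum 0 x"
proof -
  have "weight n 1 = weight n 0" for n
    by (simp add: weight_def)
  then show ?thesis
    by (simp only: defect_sum_def)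
qed

text \<open>At \<open>j = 2\<close> the row \<open>n = 1\<close> has weight 2 and all others weight
  1, so exactly one defect is counted twice.\<close>

lemma defect_sum_2: "defect_sum 2 x = defect_sum 0 x + (norm (defect (T x)))\<^sup>2"
proof -
  define h where "h n = (norm (defect ((T ^^ n) x)))\<^sup>2" for n
  have "(\<lambda>n. if n = 1 then h n else 0) sums h 1"
    using sums_single[of 1 h] by simp
  moreover have "h sums defect_sum 0 x"
    using summable_sums[OF summable_defect[of x]]
    by (simp add: h_def[abs_def] defect_sum_def)
  ultimately have "(\<lambda>n. h n + (if n = 1 then h n else 0)) sums (defect_sum 0 x + h 1)"
    by (intro sums_add)
  moreover have "h n + (if n = 1 then h n else 0) = weight n 2 * h n" for n
    by (simp add: weight_def)
  ultimately show ?thesis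
    by (simp add: defect_sum_def h_def sums_iff)
qed

text \<open>Column \<open>0\<close> contributes the weighted defects. In the other columns the
  squared shift factor cancels the denominator \<open>weight n (Suc j)\<close>, which advances
  \<open>k\<close> by one.\<close>

lemma lifting_nth_has_sum:
  "((\<lambda>(n, j). weight n (j + k) / weight n j *
      (norm (lifting_nth T f (Suc (prod_encode (n, j)))))\<^sup>2) has_sum
    defect_sum k (ell2_nth f 0) + weighted_sum (Suc k) f) UNIV"
proof (rule has_sum_split_first_column)
  have "(\<lambda>n. weight n k * (norm (defect ((T ^^ n) (ell2_nth f 0))))\<^sup>2) sums
      defect_sum k (ell2_nth f 0)"
    unfolding defect_sum_def by (rule summable_sums[OF summable_weight_defect])
  then show "((\<lambda>n. case (n, 0) of (n, j) \<Rightarrow> weight n (j + k) / weight n j *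
      (norm (lifting_nth T f (Suc (prod_encode (n, j)))))\<^sup>2) has_sum
      defect_sum k (ell2_nth f 0)) UNIV"
    by (simp add: sums_nonneg_imp_has_sum)
  have "weight n (Suc j + k) / weight n (Suc j) *
      (norm (lifting_nth T f (Suc (prod_encode (n, Suc j)))))\<^sup>2 =
      weight n (j + Suc k) / weight n j * (norm (ell2_nth f (Suc (prod_encode (n, j)))))\<^sup>2" for n j
    by (simp add: power_mult_distrib)
  then show "((\<lambda>(n, j). case (n, Suc j) of (n, j) \<Rightarrow> weight n (j + k) / weight n j *
      (norm (lifting_nth T f (Suc (prod_encode (n, j)))))\<^sup>2) has_sum weighted_sum (Suc k) f) UNIV"
    using weighted_sum_has_sum[of "Suc k" f] by (simp only: prod.case)
qed

text \<open>\<open>Abs_ell2\<close> is meaningful only on square-summable sequences; summability is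
  the case \<open>k = 0\<close> of \<open>lifting_nth_has_sum\<close>, where all weight quotients
  are 1.\<close>

lemma ell2_nth_lifting: "ell2_nth (lifting T f) = lifting_nth T f"
  unfolding lifting_def
proof (rule ell2_nth_Abs)
  have "((\<lambda>(n, j). (norm (lifting_nth T f (Suc (prod_encode (n, j)))))\<^sup>2) has_sum
      defect_sum 0 (ell2_nth f 0) + weighted_sum 1 f) UNIV"
    using lifting_nth_has_sum[of 0 f] by simp
  then have "((\<lambda>i. (norm (lifting_nth T f i))\<^sup>2) has_sum
      (norm (lifting_nth T f 0))\<^sup>2 + (defect_sum 0 (ell2_nth f 0) + weighted_sum 1 f)) UNIV"
    by (rule has_sum_nat_pairs)
  then show "summable (\<lambda>i. (norm (lifting_nth T f i))\<^sup>2)"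
    using has_sum_imp_sums sums_summable by blast
qed

lemma weighted_sum_lifting:
  "weighted_sum k (lifting T f) = defect_sum k (ell2_nth f 0) + weighted_sum (Suc k) f"
  using has_sum_unique[OF weighted_sum_has_sum, of k "lifting T f"] lifting_nth_has_sum[of k f]
  by (simp add: ell2_nth_lifting)

lemma bounded_clinear_lifting: "bounded_clinear (lifting T)"
proof -
  have scaleC: "lifting T (a *\<^sub>C f) = a *\<^sub>C lifting T f" for a f
  proof (rule ell2_eqI)
    show "ell2_nth (lifting T (a *\<^sub>C f)) i = ell2_nth (a *\<^sub>C lifting T f) i" for i
      by (rule lifting_index_cases[of i])
        (simp_all add: ell2_nth_lifting bounded_clinear_scaleC[OF bounded_clinear]
          bounded_clinear_scaleC[OF bounded_clinear_funpow[OF bounded_clinear]]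
          m_defect_scaleC[OF bounded_clinear] scaleR_scaleC scaleC_scaleC mult.commute)
  qed
  have add: "lifting T (f + g) = lifting T f + lifting T g" for f g
  proof (rule ell2_eqI)
    show "ell2_nth (lifting T (f + g)) i = ell2_nth (lifting T f + lifting T g) i" for i
      by (rule lifting_index_cases[of i])
        (simp_all add: ell2_nth_lifting linear_add[OF linear]
          linear_add[OF bounded_clinear_linear[OF bounded_clinear_funpow[OF bounded_clinear]]]
          m_defect_add[OF bounded_clinear] scaleR_add_right)
  qed
  obtain B where B: "0 \<le> B" "\<And>x. norm (T x) \<le> norm x * B"
    using bounded_clinear bounded_linear.nonneg_bounded unfolding bounded_clinear_def by blast
  \<comment> \<open>\<open>B\<^sup>2\<close> bounds the entry \<open>T ?x\<close>,
    \<open>(B\<^sup>2)\<^sup>2 + 1\<close> bounds the defects through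
    \<open>defect_sum_0_le\<close>, and 3 bounds the shift.\<close>
  define C where "C = B\<^sup>2 + (B\<^sup>2)\<^sup>2 + 1 + 3"
  have sq: "(norm (T x))\<^sup>2 \<le> B\<^sup>2 * (norm x)\<^sup>2" for x
    using power_mono[OF B(2)[of x], of 2] by (simp add: power_mult_distrib mult.commute)
  have "norm (lifting T f) \<le> norm f * sqrt C" for f
  proof (rule power2_le_imp_le)
    let ?x = "ell2_nth f 0"
    have w0: "0 \<le> weighted_sum 0 f"
      using has_sum_nonneg[OF weighted_sum_has_sum[of 0 f]] by (auto simp: case_prod_unfold)
    have w1: "weighted_sum 1 f \<le> 3 * weighted_sum 0 f"
    proof (rule has_sum_mono[OF weighted_sum_has_sum has_sum_cmult_right[OF weighted_sum_has_sum]])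
      show "(case p of (n, j) \<Rightarrow>
          weight n (j + 1) / weight n j * (norm (ell2_nth f (Suc (prod_encode (n, j)))))\<^sup>2) \<le>
        3 * (case p of (n, j) \<Rightarrow>
          weight n (j + 0) / weight n j * (norm (ell2_nth f (Suc (prod_encode (n, j)))))\<^sup>2)"
        for p :: "nat \<times> nat"
      proof -
        obtain n j where p: "p = (n, j)"
          by fastforce
        have "weight n (j + 1) / weight n j \<le> 3"
          using weight_Suc_le[of n j] by (simp add: divide_le_eq)
        then show ?thesis
          unfolding p prod.case using mult_right_mono[OF _ zero_le_power2] by fastforce
      qed
    qed
    have "(norm (T (T ?x)))\<^sup>2 \<le> (B\<^sup>2)\<^sup>2 * (norm ?x)\<^sup>2"
      using order_trans[OF sq mult_left_mono[OF sq[of ?x], of "B\<^sup>2"]]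
      by (simp add: power2_eq_square mult.assoc)
    then have "(norm (lifting T f))\<^sup>2 \<le>
        (B\<^sup>2 + (B\<^sup>2)\<^sup>2 + 1) * (norm ?x)\<^sup>2 + 3 * weighted_sum 0 f"
      using sq[of ?x] defect_sum_0_le[of ?x] w1
      by (simp add: norm_eq_weighted_sum[of "lifting T f"] weighted_sum_lifting ell2_nth_lifting
          distrib_right)
    also have "\<dots> \<le> C * (norm ?x)\<^sup>2 + C * weighted_sum 0 f"
      using w0 by (intro add_mono mult_right_mono) (auto simp: C_def)
    also have "\<dots> = (norm f * sqrt C)\<^sup>2"
      by (simp add: norm_eq_weighted_sum[of f] power_mult_distrib C_def distrib_left
          distrib_right mult.commute)
    finally show "(norm (lifting T f))\<^sup>2 \<le> (norm f * sqrt C)\<^sup>2" .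
  qed (simp add: C_def)
  then have "bounded_linear (lifting T)"
    by (intro bounded_linear_intro) (auto simp: add scaleR_scaleC scaleC)
  then show ?thesis
    by (simp add: bounded_clinear_def scaleC)
qed

text \<open>The shifted coordinates of \<open>f\<close> cancel among themselves. Coordinate
  \<open>0\<close> contributes \<open>- (norm (defect ?x))^2\<close>. The defect sums leave a second
  difference along \<open>?x\<close>, \<open>T ?x\<close>, \<open>T (T ?x)\<close> plus the extra
  term of \<open>defect_sum_2\<close>, in total \<open>(norm (defect ?x))^2\<close>.\<close>

lemma third_difference_lifting:
  "(norm (lifting T (lifting T (lifting T f))))\<^sup>2 - 3 * (norm (lifting T (lifting T f)))\<^sup>2 +
    3 * (norm (lifting T f))\<^sup>2 - (norm f)\<^sup>2 = 0"
proof -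
  let ?x = "ell2_nth f 0"
  have w0: "weighted_sum 0 (lifting T g) = defect_sum 0 (ell2_nth g 0) + weighted_sum 1 g" for g
    by (simp add: weighted_sum_lifting)
  have w1: "weighted_sum 1 (lifting T g) = defect_sum 1 (ell2_nth g 0) + weighted_sum 2 g" for g
    using weighted_sum_lifting[of 1 g] by (simp only: Suc_1)
  have w2: "weighted_sum 2 (lifting T g) = defect_sum 2 (ell2_nth g 0) + weighted_sum 3 g" for g
    using weighted_sum_lifting[of 2 g] by simp
  note expand = w0 w1 w2 ell2_nth_lifting lifting_nth_simps add.assoc
  have "(norm (lifting T f))\<^sup>2 = (norm (T ?x))\<^sup>2 + defect_sum 0 ?x + weighted_sum 1 f"
    by (simp only: norm_eq_weighted_sum[of "lifting T f"] expand)
  moreover have "(norm (lifting T (lifting T f)))\<^sup>2 =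
      (norm (T (T ?x)))\<^sup>2 + defect_sum 0 (T ?x) + defect_sum 1 ?x + weighted_sum 2 f"
    by (simp only: norm_eq_weighted_sum[of "lifting T (lifting T f)"] expand)
  moreover have "(norm (lifting T (lifting T (lifting T f))))\<^sup>2 =
      (norm (T (T (T ?x))))\<^sup>2 + defect_sum 0 (T (T ?x)) + defect_sum 1 (T ?x) + defect_sum 2 ?x +
      weighted_sum 3 f"
    by (simp only: norm_eq_weighted_sum[of "lifting T (lifting T (lifting T f))"] expand)
  ultimately show ?thesis
    using third_difference_norm[of ?x] weighted_sum_third_difference[of f]
      norm_eq_weighted_sum[of f] defect_sum_T[of ?x] defect_sum_T[of "T ?x"]
      defect_sum_1[of ?x] defect_sum_1[of "T ?x"] defect_sum_2[of ?x]
    by linarith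
qed

lemma m_isometry_lifting: "m_isometry 3 (lifting T)"
proof (rule m_isometryI[OF bounded_clinear_lifting])
  show "inner f (m_defect 3 (lifting T) f) = 0" for f
    using third_difference_lifting[of f]
    unfolding power2_norm_eq_inner
    by (simp add: inner_m_defect[OF bounded_clinear_lifting] eval_nat_numeral)
qed

text \<open>Coordinate \<open>0\<close> of a lifted vector depends on coordinate \<open>0\<close>
  alone, so all powers compress correctly at once.\<close>

lemma ell2_nth_lifting_funpow: "ell2_nth ((lifting T ^^ n) f) 0 = (T ^^ n) (ell2_nth f 0)"
  by (induction n) (simp_all add: ell2_nth_lifting)

end

section \<open>Coordinate 0 as the embedded copy of the given space\<close>

definition ell2_embed :: "'a :: chilbert_space \<Rightarrow> 'a ell2"
  where "ell2_embed x = Abs_ell2 (\<lambda>i. if i = 0 then x else 0)"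

lemma ell2_nth_embed: "ell2_nth (ell2_embed x) i = (if i = 0 then x else 0)"
proof -
  have "summable (\<lambda>i. (norm (if i = 0 then x else 0))\<^sup>2)"
    by (rule summable_finite[of "{0}"]) auto
  then show ?thesis
    by (simp add: ell2_embed_def ell2_nth_Abs)
qed

lemma cinner_zero_left: "cinner 0 x = 0"
  using cinner_add_left[of 0 0 x] by simp

text \<open>Reading off coordinate \<open>0\<close> is adjoint to the embedding, which identifies
  the projection onto its range.\<close>

lemma cinner_ell2_embed: "cinner (ell2_embed x) f = cinner x (ell2_nth f 0)"
  unfolding cinner_ell2_def
  by (subst suminf_finite[of "{0}"]) (auto simp: ell2_nth_embed cinner_zero_left)

lemma isometric_embedding_ell2_embed: "isometric_embedding ell2_embed"
proof -
  have inner: "cinner (ell2_embed x) (ell2_embed y) = cinner x y" for x y :: 'a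
    by (simp add: cinner_ell2_embed ell2_nth_embed)
  then have norm: "norm (ell2_embed x) = norm x" for x :: 'a
    by (simp add: norm_eq_sqrt_inner inner_eq_Re_cinner)
  \<comment> \<open>The instance of \<open>scaleC_add_right\<close> at zero vectors gives
    \<open>a *\<^sub>C 0 = 0\<close>, for the coordinates other than \<open>0\<close>.\<close>
  have scaleC: "ell2_embed (a *\<^sub>C x) = a *\<^sub>C ell2_embed x" for a and x :: 'a
    using scaleC_add_right[of a "0 :: 'a" 0] by (intro ell2_eqI) (simp add: ell2_nth_embed)
  have "bounded_linear (ell2_embed :: 'a \<Rightarrow> 'a ell2)"
  proof (rule bounded_linear_intro[where K = 1])
    show "ell2_embed (x + y) = ell2_embed x + ell2_embed y" for x y :: 'a
      by (intro ell2_eqI) (simp add: ell2_nth_embed)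
  qed (simp_all add: scaleR_scaleC scaleC norm)
  then show ?thesis
    by (simp add: isometric_embedding_def bounded_clinear_def scaleC inner)
qed

lemma orthogonal_projection_ell2_embed:
  "orthogonal_projection (range ell2_embed) f = ell2_embed (ell2_nth f 0)"
proof (rule orthogonal_projection_eqI[OF isometric_embedding_ell2_embed])
  fix w :: 'a
  show "cinner (f - ell2_embed (ell2_nth f 0)) (ell2_embed w) = 0"
    by (subst cinner_commute)
      (simp add: cinner_ell2_embed ell2_nth_embed cinner_commute[of w] cinner_zero_left)
qed

lemma m_partial_isometry_3_dilation:
  assumes "m_partial_isometry 3 T"
  shows "m_isometric_dilation 3 T ell2_embed (lifting T)"
proof -
  interpret three_partial_isometry T
    by unfold_locales (fact assms)
  show ?thesis
    unfolding m_isometric_dilation_def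
    by (simp add: isometric_embedding_ell2_embed m_isometry_lifting
        orthogonal_projection_ell2_embed ell2_nth_lifting_funpow ell2_nth_embed)
qed

theorem theorem4p10:
  fixes T :: "'a :: chilbert_space \<Rightarrow> 'a" and m :: nat
  assumes "m \<ge> 1" and "m_partial_isometry m T"
  shows "(even m \<and> spectral_radius T > 1 \<longrightarrow>
      (\<forall>m'\<ge>1. \<not> (\<exists>(J :: 'a \<Rightarrow> 'k :: chilbert_space) V. m_isometric_dilation m' T J V)))
    \<and> (m = 3 \<longrightarrow> (\<exists>(J :: 'a \<Rightarrow> 'a ell2) V. m_isometric_dilation 3 T J V))"
proof (intro conjI impI allI notI)
  fix m'
  assume "even m \<and> spectral_radius T > 1"
    and "\<exists>(J :: 'a \<Rightarrow> 'k) V. m_isometric_dilation m' T J V"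
  then show False
    using assms(2) m_isometric_dilation_spectral_radius[of T m']
    by (force simp: m_partial_isometry_def)
next
  assume "m = 3"
  then show "\<exists>(J :: 'a \<Rightarrow> 'a ell2) V. m_isometric_dilation 3 T J V"
    using assms(2) m_partial_isometry_3_dilation by blast
qed

end
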